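(* Let $n,k$ be integers with $1\le k\le \frac n2-1$, and let $T\in\mathcal T_{n,k}$. Then $$\prod\nolimits_2(T)\ \ge\ (3^3)^{k}(2^2)^{\,n-2k-2}=\left(\tfrac{27}{16}\right)^{k}4^{\,n-2},$$ and equality holds if and only if the degree sequence of $T$ is $$(\underbrace{3,\ldots,3}_{k},\underbrace{2,\ldots,2}_{n-2k-2},\underbrace{1,\ldots,1}_{k+2}).$$
   Context: All graphs are finite, simple, connected and undirected; $d(v)$ denotes the degree of a vertex $v$. $\mathcal T_{n,k}$ is the class of trees with $n$ vertices in which exactly $k$ vertices have degree equal to the maximum vertex degree of the tree. The second multiplicative Zagreb index of a graph $G$ is $\prod_2(G)=\prod_{uv\in E(G)}d(u)d(v)=\prod_{u\in V(G)}d(u)^{d(u)}$. The degree sequence of a graph is the list of its vertex degrees in non-increasing order. *)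

theory Defs
  imports Complex_Main "HOL-Library.Multiset" "Graph_Theory.Digraph_Component"
begin

text \<open>
  A finite simple undirected graph is a \<^locale>\<open>pair_graph\<close>: a finite vertex set with a
  finite, loop-free, symmetric set of arcs, so that every undirected edge occurs as two
  opposite arcs. The degree of a vertex is therefore its out-degree, and an undirected
  edge is recovered as the set of its two ends.
\<close>

definition degree :: "'a pair_pre_digraph \<Rightarrow> 'a \<Rightarrow> nat" where
  "degree G v = out_degree (with_proj G) v"

definition edges :: "'a pair_pre_digraph \<Rightarrow> 'a set set" where
  "edges G = {{u, v} |u v. (u, v) \<in> parcs G}"

text \<open>
  The library predicate \<^const>\<open>tree\<close> is not suitable here: in a symmetric digraph the closed
  walk along an edge and back is a \<^const>\<open>pre_digraph.cycle\<close> of length 2. In a loop-free graph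
  the undirected cycles are exactly the cycles of length at least 3.
\<close>

definition undirected_tree :: "'a pair_pre_digraph \<Rightarrow> bool" where
  "undirected_tree G \<longleftrightarrow> pair_graph G \<and> Digraph_Component.connected (with_proj G) \<and>
     \<not> (\<exists>p. pre_digraph.cycle (with_proj G) p \<and> 3 \<le> length p)"

definition max_degree :: "'a pair_pre_digraph \<Rightarrow> nat" where
  "max_degree G = Max (degree G ` pverts G)"

definition trees_with_max_degree_count :: "nat \<Rightarrow> nat \<Rightarrow> 'a pair_pre_digraph set" where
  "trees_with_max_degree_count n k =
     {T. undirected_tree T \<and> card (pverts T) = n \<and>
         card {v \<in> pverts T. degree T v = max_degree T} = k}"

definition second_multiplicative_Zagreb :: "'a pair_pre_digraph \<Rightarrow> nat" where
  "second_multiplicative_Zagreb G = (\<Prod>e\<in>edges G. \<Prod>v\<in>e. degree G v)"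

definition degree_sequence :: "'a pair_pre_digraph \<Rightarrow> nat list" where
  "degree_sequence G =
     rev (sorted_list_of_multiset (image_mset (degree G) (mset_set (pverts G))))"

end

theory Submission
  imports Defs
begin

text \<open>
  By double counting, the index is the product of \<open>d ^ d\<close> over the vertex degrees \<open>d\<close>. Each
  \<open>d \<ge> 1\<close> satisfies \<open>d ^ d \<ge> 4 ^ (d - 1)\<close>, with equality only for \<open>d \<le> 2\<close>, and each
  \<open>d \<ge> 3\<close> satisfies \<open>d ^ d \<ge> (27 / 16) * 4 ^ (d - 1)\<close>, with equality only for \<open>d = 3\<close>.
  The maximum degree is at least 3, since otherwise the degree sum is at most
  \<open>n + k < 2 * (n - 1)\<close>, so the second bound applies to the \<open>k\<close> vertices of maximum degree and
  the first one to the others. Since the sum of \<open>d - 1\<close> is at least \<open>n - 2\<close>, the product of these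
  bounds is at least \<open>(27 / 16) ^ k * 4 ^ (n - 2)\<close>. Connectedness alone is responsible for
  \<open>2 * (n - 1) \<le> \<Sum>d\<close>: in breadth-first order each vertex but the root has an edge to its parent.
\<close>

section \<open>Counting pairs in a connected symmetric relation\<close>

lemma card_rooted_symmetric_relation:
  fixes R :: "('a \<times> 'a) set"
  assumes "finite R" "sym R" "finite V" "r \<in> V"
    and reach: "\<And>v. v \<in> V \<Longrightarrow> (r, v) \<in> R\<^sup>*"
  shows "2 * (card V - 1) \<le> card R"
proof -
  \<comment> \<open>Distance from the root \<open>r\<close>. The last step of a shortest path to
    \<open>v\<close> supplies a parent strictly closer to \<open>r\<close>.\<close>
  define dist where "dist v = (LEAST m. (r, v) \<in> R ^^ m)" for v
  have parent: "\<exists>p. (p, v) \<in> R \<and> dist p < dist v" if vV: "v \<in> V - {r}" for v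
  proof -
    have "\<exists>m. (r, v) \<in> R ^^ m"
      using reach that rtrancl_imp_relpow by blast
    then have v: "(r, v) \<in> R ^^ dist v"
      unfolding dist_def by (rule LeastI_ex)
    then obtain m where m: "dist v = Suc m"
      using vV v by (cases "dist v") auto
    with v obtain p where p: "(r, p) \<in> R ^^ m" "(p, v) \<in> R"
      by auto
    have "dist p \<le> m"
      unfolding dist_def using p(1) by (rule Least_le)
    with p m show ?thesis by auto
  qed
  then obtain parent where
    parent: "\<And>v. v \<in> V - {r} \<Longrightarrow> (parent v, v) \<in> R \<and> dist (parent v) < dist v"
    by metis
  let ?up = "(\<lambda>v. (v, parent v)) ` (V - {r})" and ?down = "(\<lambda>v. (parent v, v)) ` (V - {r})"
  \<comment> \<open>A common pair would make two vertices parents of each other, so each would be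
    strictly closer to \<open>r\<close> than the other.\<close>
  have disjoint: "?up \<inter> ?down = {}"
    using parent by (auto, metis less_asym)
  have "card ?up = card V - 1" "card ?down = card V - 1"
    using assms by (subst card_image; auto simp: inj_on_def)+
  then have "2 * (card V - 1) = card (?up \<union> ?down)"
    using disjoint \<open>finite V\<close> by (subst card_Un_disjoint) auto
  also have "\<dots> \<le> card R"
    using parent symD[OF \<open>sym R\<close>] by (intro card_mono \<open>finite R\<close>) blast
  finally show ?thesis .
qed

section \<open>Degrees, the vertex form of the index, and connectedness\<close>

context pair_graph
begin

lemma finite_neighbours: "finite {w. (v, w) \<in> parcs G}"
  by (rule finite_subset[of _ "snd ` parcs G"]) force+

lemma degree_eq_card_neighbours: "degree G v = card {w. (v, w) \<in> parcs G}"
proof -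
  have "out_arcs (with_proj G) v = Pair v ` {w. (v, w) \<in> parcs G}"
    by (auto simp: out_arcs_def)
  then show ?thesis
    by (simp add: degree_def out_degree_def card_image inj_on_def)
qed

text \<open>Arcs are grouped by their tails. This is the handshake identity, the factor 2 being
  absorbed by the two opposite arcs of each edge.\<close>

lemma sum_degree: "(\<Sum>v\<in>pverts G. degree G v) = card (parcs G)"
proof -
  have "parcs G = (SIGMA v:pverts G. {w. (v, w) \<in> parcs G})"
    using wellformed' by auto
  then have "card (parcs G) = (\<Sum>v\<in>pverts G. card {w. (v, w) \<in> parcs G})"
    by (metis card_SigmaI finite_neighbours pair_finite_verts)
  then show ?thesis
    by (simp add: degree_eq_card_neighbours)
qed

lemma second_multiplicative_Zagreb_eq:
  "second_multiplicative_Zagreb G = (\<Prod>v\<in>pverts G. degree G v ^ degree G v)"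
proof -
  have "edges G = (\<lambda>(u, v). {u, v}) ` parcs G"
    by (auto simp: edges_def)
  then have fin: "finite (edges G)"
    by simp
  have ends: "{v \<in> pverts G. v \<in> e} = e" if "e \<in> edges G" for e
    using that wellformed' by (auto simp: edges_def)
  have card_incident: "card {e \<in> edges G. v \<in> e} = degree G v" for v
  proof -
    have "{e \<in> edges G. v \<in> e} = (\<lambda>w. {v, w}) ` {w. (v, w) \<in> parcs G}"
      using arcs_symmetric by (auto simp: edges_def)
    moreover have "inj_on (\<lambda>w. {v, w}) {w. (v, w) \<in> parcs G}"
      by (auto simp: inj_on_def doubleton_eq_iff)
    ultimately show ?thesis
      by (simp add: card_image degree_eq_card_neighbours)
  qed
  \<comment> \<open>Writing an edge as the vertices lying in it makes both products range over one
    incidence relation, so they can be swapped; \<open>v\<close> then contributes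
    \<open>degree G v\<close> once per incident edge.\<close>
  have "second_multiplicative_Zagreb G
      = (\<Prod>e\<in>edges G. \<Prod>v\<in>{v \<in> pverts G. v \<in> e}. degree G v)"
    unfolding second_multiplicative_Zagreb_def by (intro prod.cong) (auto simp: ends)
  also have "\<dots> = (\<Prod>v\<in>pverts G. \<Prod>e\<in>{e \<in> edges G. v \<in> e}. degree G v)"
    using fin pair_finite_verts by (rule prod.swap_restrict)
  finally show ?thesis
    by (simp add: card_incident)
qed

text \<open>Connectedness ignores arc directions, but here every arc has its reverse, so undirected
  paths are directed ones.\<close>

lemma connected_imp_rtrancl_parcs:
  assumes "Digraph_Component.connected (with_proj G)" "u \<in> pverts G" "v \<in> pverts G"
  shows "(u, v) \<in> (parcs G)\<^sup>*"
proof -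
  have "u \<rightarrow>\<^sup>*\<^bsub>with_proj G\<^esub> v"
    using symmetric_connected_imp_strongly_connected[OF sym_arcs assms(1)] assms(2,3)
    by (auto simp: strongly_connected_def)
  then show ?thesis
    by (simp add: reachable_def rtrancl_on_rtranclI)
qed

lemma connected_sum_degree_ge:
  assumes "Digraph_Component.connected (with_proj G)"
  shows "2 * (card (pverts G) - 1) \<le> (\<Sum>v\<in>pverts G. degree G v)"
proof (cases "pverts G = {}")
  case False
  then obtain r where "r \<in> pverts G" by blast
  then have "2 * (card (pverts G) - 1) \<le> card (parcs G)"
    using connected_imp_rtrancl_parcs[OF assms] sym_arcs
    by (intro card_rooted_symmetric_relation) (auto simp: symmetric_def)
  then show ?thesis
    by (simp add: sum_degree)
qed simp

lemma connected_degree_pos: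
  assumes "Digraph_Component.connected (with_proj G)" "2 \<le> card (pverts G)" "v \<in> pverts G"
  shows "1 \<le> degree G v"
proof -
  have "pverts G \<noteq> {v}"
    using assms(2) by auto
  then obtain u where "u \<in> pverts G" "u \<noteq> v"
    using assms(3) by blast
  then have "(v, u) \<in> (parcs G)\<^sup>*" "v \<noteq> u"
    using connected_imp_rtrancl_parcs assms by auto
  \<comment> \<open>The first arc of a path from \<open>v\<close> to another vertex.\<close>
  then obtain w where "(v, w) \<in> parcs G"
    by (meson converse_rtranclE)
  then have "{w. (v, w) \<in> parcs G} \<noteq> {}" by blast
  then show ?thesis
    using finite_neighbours by (simp add: degree_eq_card_neighbours Suc_le_eq card_gt_0_iff)
qed

end

section \<open>Numerical bounds on the product of self-powers\<close>

lemma power_self_ge: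
  fixes d :: nat
  assumes "1 \<le> d"
  shows "4 ^ (d - 1) \<le> d ^ d" and "4 ^ (d - 1) = d ^ d \<Longrightarrow> d = 1 \<or> d = 2"
    and "3 \<le> d \<Longrightarrow> 27 * 4 ^ (d - 1) \<le> 16 * d ^ d"
    and "3 \<le> d \<Longrightarrow> 27 * 4 ^ (d - 1) = 16 * d ^ d \<Longrightarrow> d = 3"
proof -
  \<comment> \<open>For \<open>d \<ge> 4\<close> the base comparison
    \<open>4 ^ d \<le> d ^ d\<close> suffices: 64 exceeds both 27 and 16, so both bounds are strict
    there.\<close>
  have "d = 1 \<or> d = 2 \<or> d = 3 \<or> 64 * 4 ^ (d - 1) \<le> 16 * d ^ d"
  proof (cases "4 \<le> d")
    case True
    have "(64::nat) * 4 ^ (d - 1) = 16 * 4 ^ d"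
      using assms by (cases d) auto
    also have "\<dots> \<le> 16 * d ^ d"
      using True by (simp add: power_mono)
    finally show ?thesis by simp
  qed (use assms in linarith)
  moreover have "(4::nat) ^ (d - 1) > 0" by simp
  ultimately show "4 ^ (d - 1) \<le> d ^ d" and "4 ^ (d - 1) = d ^ d \<Longrightarrow> d = 1 \<or> d = 2"
    and "3 \<le> d \<Longrightarrow> 27 * 4 ^ (d - 1) \<le> 16 * d ^ d"
    and "3 \<le> d \<Longrightarrow> 27 * 4 ^ (d - 1) = 16 * d ^ d \<Longrightarrow> d = 3"
    by (auto, linarith+)
qed

text \<open>The factor \<open>16 ^ k\<close> clears the denominators, so that all bounds stay in the natural numbers.\<close>

lemma prod_self_powers:
  fixes d :: "'a \<Rightarrow> nat"
  assumes fin: "finite V" and pos: "\<And>v. v \<in> V \<Longrightarrow> 1 \<le> d v" and D: "3 \<le> D"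
    and k: "card {v \<in> V. d v = D} = k"
    and sum: "2 * (card V - 1) \<le> (\<Sum>v\<in>V. d v)"
  shows "27 ^ k * 4 ^ (card V - 2) \<le> 16 ^ k * (\<Prod>v\<in>V. d v ^ d v)" (is "?L \<le> ?R")
    and "27 ^ k * 4 ^ (card V - 2) = 16 ^ k * (\<Prod>v\<in>V. d v ^ d v) \<Longrightarrow> v \<in> V \<Longrightarrow>
      if d v = D then d v = 3 else d v = 1 \<or> d v = 2"
    and "27 ^ k * 4 ^ (card V - 2) = 16 ^ k * (\<Prod>v\<in>V. d v ^ d v) \<Longrightarrow>
      (\<Sum>v\<in>V. d v - 1) = card V - 2"
proof -
  \<comment> \<open>\<open>f\<close> collects the lower bounds and \<open>g\<close> the true
    factors; the ratio 27/16 at vertices of degree \<open>D\<close> is split between them.\<close>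
  define f g :: "'a \<Rightarrow> nat" where "f v = (if d v = D then 27 else 1) * 4 ^ (d v - 1)"
    and "g v = (if d v = D then 16 else 1) * d v ^ d v" for v
  have weight: "(\<Prod>v\<in>V. if d v = D then c else 1) = c ^ k" for c :: nat
    using fin k by (simp flip: prod.inter_filter)
  have fg: "f v \<le> g v" if "v \<in> V" for v
    using power_self_ge[OF pos[OF that]] D by (auto simp: f_def g_def)
  have g_pos: "0 < g v" if "v \<in> V" for v
    using pos[OF that] by (auto simp: g_def)
  have prod_f: "prod f V = 27 ^ k * 4 ^ (\<Sum>v\<in>V. d v - 1)"
    by (simp add: f_def prod.distrib weight power_sum)
  have prod_g: "prod g V = ?R"
    by (simp add: g_def prod.distrib weight)
  have "(\<Sum>v\<in>V. d v - 1 + 1) = (\<Sum>v\<in>V. d v)"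
    using pos by (intro sum.cong refl le_add_diff_inverse2)
  then have "(\<Sum>v\<in>V. d v - 1) + card V = (\<Sum>v\<in>V. d v)"
    by (simp only: sum.distrib) simp
  then have sum': "card V - 2 \<le> (\<Sum>v\<in>V. d v - 1)"
    using sum by linarith
  then have L: "?L \<le> prod f V"
    by (simp add: prod_f power_increasing)
  have prod_fg: "prod f V \<le> prod g V"
    using fg by (intro prod_mono) auto
  show "?L \<le> ?R"
    using L prod_fg prod_g by simp
  assume eq: "?L = ?R"
  \<comment> \<open>Equality of the two ends collapses the chain through \<open>prod f V\<close> and
    \<open>prod g V\<close>.\<close>
  then have prod_eq: "prod f V = prod g V" and "?L = prod f V"
    using L prod_fg prod_g by linarith+
  from \<open>?L = prod f V\<close> show "(\<Sum>v\<in>V. d v - 1) = card V - 2"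
    unfolding prod_f by simp
  assume v: "v \<in> V"
  \<comment> \<open>All factors of \<open>g\<close> are positive, so one strict inequality would
    make the whole product strict.\<close>
  have "f v = g v"
  proof (rule ccontr)
    assume "f v \<noteq> g v"
    then have "f v < g v"
      using fg[OF v] by simp
    then have "prod f V < prod g V"
      using fin v fg g_pos by (intro prod_mono_strict[of v]) auto
    then show False
      using prod_eq by simp
  qed
  then show "if d v = D then d v = 3 else d v = 1 \<or> d v = 2"
    using power_self_ge[OF pos[OF v]] D by (auto simp: f_def g_def)
qed

section \<open>Recovering the degree sequence\<close>

lemma image_mset_degrees_eq:
  fixes d :: "'a \<Rightarrow> nat"
  assumes fin: "finite V" and range: "\<And>v. v \<in> V \<Longrightarrow> d v \<in> {1, 2, 3}"
    and k: "card {v \<in> V. d v = 3} = k" and n: "2 * k + 2 \<le> card V"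
    and sum: "(\<Sum>v\<in>V. d v - 1) = card V - 2"
  shows "image_mset d (mset_set V) =
    replicate_mset k 3 + replicate_mset (card V - 2 * k - 2) 2 + replicate_mset (k + 2) 1"
proof -
  have count: "count (image_mset d (mset_set V)) x = card {v \<in> V. d v = x}" for x
    using fin by (simp add: count_image_mset' flip: card_eq_sum) metis
  \<comment> \<open>A vertex of degree 1, 2 or 3 contributes 0, 1 or 2 to the sum. With
    \<open>k\<close> known this fixes the number of 2s, and then \<open>card V\<close> fixes the
    number of 1s.\<close>
  have "d v - 1 = (if d v = 2 then 1 else 0) + (if d v = 3 then 2 else 0)" if "v \<in> V" for v
    using range[OF that] by auto
  then have "(\<Sum>v\<in>V. d v - 1)
      = (\<Sum>v\<in>V. (if d v = 2 then 1 else 0) + (if d v = 3 then 2 else 0))"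
    by (rule sum.cong[OF refl])
  also have "\<dots> = card {v \<in> V. d v = 2} + 2 * k"
    using fin k by (simp add: sum.distrib flip: sum.inter_filter)
  finally have c2: "card {v \<in> V. d v = 2} = card V - 2 * k - 2"
    using sum n by linarith
  have "V = {v \<in> V. d v = 1} \<union> ({v \<in> V. d v = 2} \<union> {v \<in> V. d v = 3})"
    using range by auto
  moreover have "card ({v \<in> V. d v = 1} \<union> ({v \<in> V. d v = 2} \<union> {v \<in> V. d v = 3}))
      = card {v \<in> V. d v = 1} + (card {v \<in> V. d v = 2} + card {v \<in> V. d v = 3})"
    using fin by (simp add: card_Un_disjoint disjoint_iff)
  ultimately have "card V = card {v \<in> V. d v = 1} + (card {v \<in> V. d v = 2} + card {v \<in> V. d v = 3})"
    by simp
  then have c1: "card {v \<in> V. d v = 1} = k + 2"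
    using c2 k n by linarith
  have "card {v \<in> V. d v = x} = 0" if "x \<notin> {1, 2, 3}" for x
    using range that by (auto simp: card_eq_0_iff)
  then show ?thesis
    using c1 c2 k by (intro multiset_eqI) (auto simp: count)
qed

text \<open>A sorted list is determined by its multiset, so comparing sequences reduces to counting
  degrees.\<close>

lemma degree_sequence_eq_iff:
  assumes "sorted (rev xs)"
  shows "degree_sequence G = xs \<longleftrightarrow> image_mset (degree G) (mset_set (pverts G)) = mset xs"
proof
  assume "degree_sequence G = xs"
  then show "image_mset (degree G) (mset_set (pverts G)) = mset xs"
    by (auto simp: degree_sequence_def)
next
  assume "image_mset (degree G) (mset_set (pverts G)) = mset xs"
  then show "degree_sequence G = xs"
    using assms by (simp add: degree_sequence_def rev_swap) (metis mset_rev properties_for_sort)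
qed

theorem theorem4p1:
  fixes n k :: nat and T :: "'a pair_pre_digraph"
  assumes "1 \<le> k"
    and "real k \<le> real n / 2 - 1"
    and "T \<in> trees_with_max_degree_count n k"
  shows "second_multiplicative_Zagreb T \<ge> (3 ^ 3) ^ k * (2 ^ 2) ^ (n - 2 * k - 2)
    \<and> real ((3 ^ 3) ^ k * (2 ^ 2) ^ (n - 2 * k - 2)) = (27 / 16) ^ k * 4 ^ (n - 2)
    \<and> (second_multiplicative_Zagreb T = (3 ^ 3) ^ k * (2 ^ 2) ^ (n - 2 * k - 2) \<longleftrightarrow>
        degree_sequence T = replicate k 3 @ replicate (n - 2 * k - 2) 2 @ replicate (k + 2) 1)"
proof -
  have tree: "pair_graph T" "Digraph_Component.connected (with_proj T)"
    and n: "card (pverts T) = n"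
    and k: "card {v \<in> pverts T. degree T v = max_degree T} = k"
    using assms(3) by (auto simp: trees_with_max_degree_count_def undirected_tree_def)
  interpret pair_graph T by fact
  have nk: "2 * k + 2 \<le> n"
    using assms(2) by linarith
  have sum: "2 * (n - 1) \<le> (\<Sum>v\<in>pverts T. degree T v)"
    using connected_sum_degree_ge[OF tree(2)] n by simp
  have pos: "1 \<le> degree T v" if "v \<in> pverts T" for v
    using connected_degree_pos[OF tree(2) _ that] n nk by simp
  have le_max: "degree T v \<le> max_degree T" if "v \<in> pverts T" for v
    using that pair_finite_verts by (simp add: max_degree_def)
  have max: "3 \<le> max_degree T"
  proof (rule ccontr)
    assume "\<not> 3 \<le> max_degree T"
    \<comment> \<open>With maximum at most 2, a vertex not attaining it has degree at most
      1.\<close>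
    then have "degree T v \<le> 1 + (if degree T v = max_degree T then 1 else 0)"
      if "v \<in> pverts T" for v
      using le_max[OF that] by auto
    then have "(\<Sum>v\<in>pverts T. degree T v)
        \<le> (\<Sum>v\<in>pverts T. 1 + (if degree T v = max_degree T then 1 else 0))"
      by (rule sum_mono)
    also have "\<dots> = n + k"
      using n k by (simp only: sum.distrib flip: sum.inter_filter[OF pair_finite_verts]) simp
    finally show False
      using sum nk assms(1) by linarith
  qed
  note zagreb = second_multiplicative_Zagreb_eq
  define bound :: nat where "bound = 27 ^ k * 4 ^ (n - 2 * k - 2)"
  \<comment> \<open>Splitting off \<open>4 ^ (2 * k)\<close> exposes the factor
    \<open>16 ^ k\<close> to be cancelled; \<open>nk\<close> keeps the subtractions exact.\<close>
  have "(4::nat) ^ (n - 2) = 4 ^ (2 * k + (n - 2 * k - 2))"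
    using nk by simp
  also have "\<dots> = 16 ^ k * 4 ^ (n - 2 * k - 2)"
    by (simp add: power_add power_mult)
  finally have four: "(4::nat) ^ (n - 2) = 16 ^ k * 4 ^ (n - 2 * k - 2)" .
  then have bound: "27 ^ k * 4 ^ (n - 2) = 16 ^ k * bound"
    by (simp add: bound_def)
  note degrees = prod_self_powers[OF pair_finite_verts pos max k, unfolded n,
      OF _ sum, folded zagreb, unfolded bound]
  have lower: "bound \<le> second_multiplicative_Zagreb T"
    using degrees(1) by simp
  have "real bound = (27 / 16) ^ k * 4 ^ (n - 2)"
    using arg_cong[OF four, of real] by (simp add: bound_def power_divide)
  moreover define xs :: "nat list"
    where "xs = replicate k 3 @ replicate (n - 2 * k - 2) 2 @ replicate (k + 2) 1"
  have sorted: "sorted (rev xs)"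
    by (auto simp: xs_def sorted_append)
  have "second_multiplicative_Zagreb T = bound \<longleftrightarrow> degree_sequence T = xs"
  proof
    assume eq: "second_multiplicative_Zagreb T = bound"
    have cases: "if degree T v = max_degree T then degree T v = 3
        else degree T v = 1 \<or> degree T v = 2" if "v \<in> pverts T" for v
      using degrees(2)[OF _ _ that] eq by presburger
    \<comment> \<open>Since \<open>k \<ge> 1\<close>, some vertex attains the maximum, and its
      equality case forces that maximum to be 3.\<close>
    have "{v \<in> pverts T. degree T v = max_degree T} \<noteq> {}"
      using k assms(1) by force
    then obtain w where "w \<in> pverts T" "degree T w = max_degree T"
      by blast
    then have "max_degree T = 3"
      using cases[of w] by simp
    have "image_mset (degree T) (mset_set (pverts T)) =
        replicate_mset k 3 + replicate_mset (card (pverts T) - 2 * k - 2) 2 + replicate_mset (k + 2) 1"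
    proof (rule image_mset_degrees_eq[OF pair_finite_verts])
      show "degree T v \<in> {1, 2, 3}" if "v \<in> pverts T" for v
        using cases[OF that] by (auto split: if_splits)
      show "card {v \<in> pverts T. degree T v = 3} = k"
        using k \<open>max_degree T = 3\<close> by simp
      show "(\<Sum>v\<in>pverts T. degree T v - 1) = card (pverts T) - 2"
        using degrees(3) eq n by simp
    qed (use n nk in simp)
    then have "image_mset (degree T) (mset_set (pverts T)) = mset xs"
      by (simp add: xs_def n)
    then show "degree_sequence T = xs"
      by (rule degree_sequence_eq_iff[OF sorted, THEN iffD2])
  next
    assume "degree_sequence T = xs"
    then have "image_mset (degree T) (mset_set (pverts T)) = mset xs"
      by (rule degree_sequence_eq_iff[OF sorted, THEN iffD1])
    \<comment> \<open>The index depends only on the multiset of degrees, whose entries 3, 2, 1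
      contribute 27, 4, 1.\<close>
    then have "(\<Prod>d\<in>#image_mset (degree T) (mset_set (pverts T)). d ^ d) = bound"
      by (simp add: xs_def bound_def)
    then show "second_multiplicative_Zagreb T = bound"
      by (simp add: zagreb prod_unfold_prod_mset multiset.map_comp comp_def)
  qed
  ultimately show ?thesis
    using lower by (simp add: bound_def xs_def)
qed

end
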